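(* For all $n\ge 0$ and any modal formula $\varphi$, the following are equivalent: 1. $\varphi$ is a theorem of $\mathrm{K4}\mathbb{C}_n$; 2. $\varphi$ is valid in all transitive frames that have circumference at most $n$ and no strictly ascending chains; 3. $\varphi$ is valid in all finite transitive frames that have circumference at most $n$.
   Context: Modal formulas are built from variables by $\top,\neg,\wedge,\Box$, with $\Diamond=\neg\Box\neg$, $\Box^*\varphi=\varphi\wedge\Box\varphi$; validity in a frame $(W,R)$ means truth at every point of every Kripke model on it. A normal logic is a set of formulas containing all tautologies and all instances of $\Box(\varphi\to\psi)\to(\Box\varphi\to\Box\psi)$, closed under modus ponens, $\Box$-generalisation and uniform substitution. Define $\mathbb{P}_0(\varphi_0)=\Diamond\varphi_0$, $\mathbb{P}_n(\varphi_0,\dots,\varphi_n)=\Diamond(\varphi_1\wedge\mathbb{P}_{n-1}(\varphi_0,\varphi_2,\dots,\varphi_n))$ for $n>0$; $\mathbb{D}_n=\bigwedge_{i<j\le n}\neg(\varphi_i\wedge\varphi_j)$ ($=\top$ if $n=0$); $\mathbb{C}_n$ is the scheme $\Box^*\mathbb{D}_n\to(\Diamond\varphi_0\to\Diamond(\varphi_0\wedge\neg\mathbb{P}_n))$. $\mathrm{K4}\mathbb{C}_n$ is the smallest normal logic containing all instances of $\Box\varphi\to\Box\Box\varphi$ and of $\mathbb{C}_n$. An $n$-cycle is a sequence of $n\ge1$ distinct points $x_0,\dots,x_{n-1}$ with $x_0R\cdots Rx_{n-1}Rx_0$; the circumference of a frame is the supremum of the lengths of its cycles (0 if none). A strictly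 ascending chain is a sequence $(x_m)_{m<\omega}$ with $x_mRx_{m+1}$ and not $x_{m+1}Rx_m$ for all $m$. *)

theory Defs
  imports Main "HOL-Library.Extended_Nat"
begin

datatype 'v fm =
    Var 'v
  | Top
  | Neg "'v fm"
  | And "'v fm" "'v fm"
  | Box "'v fm"

definition Imp :: "'v fm \<Rightarrow> 'v fm \<Rightarrow> 'v fm" where
  "Imp p q = Neg (And p (Neg q))"

definition Dia :: "'v fm \<Rightarrow> 'v fm" where
  "Dia p = Neg (Box (Neg p))"

definition BoxStar :: "'v fm \<Rightarrow> 'v fm" where
  "BoxStar p = And p (Box p)"

fun Conj :: "'v fm list \<Rightarrow> 'v fm" where
  "Conj [] = Top"
| "Conj (p # ps) = And p (Conj ps)"

primrec subst_fm :: "('v \<Rightarrow> 'v fm) \<Rightarrow> 'v fm \<Rightarrow> 'v fm" where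
  "subst_fm s (Var v) = s v"
| "subst_fm s Top = Top"
| "subst_fm s (Neg p) = Neg (subst_fm s p)"
| "subst_fm s (And p q) = And (subst_fm s p) (subst_fm s q)"
| "subst_fm s (Box p) = Box (subst_fm s p)"

text \<open>For tautologies, variables and boxed formulas are propositional atoms; the function
  \<open>e\<close> assigns them arbitrary truth values.\<close>

primrec bool_eval :: "('v fm \<Rightarrow> bool) \<Rightarrow> 'v fm \<Rightarrow> bool" where
  "bool_eval e (Var v) = e (Var v)"
| "bool_eval e Top = True"
| "bool_eval e (Neg p) = (\<not> bool_eval e p)"
| "bool_eval e (And p q) = (bool_eval e p \<and> bool_eval e q)"
| "bool_eval e (Box p) = e (Box p)"

definition tautology :: "'v fm \<Rightarrow> bool" where
  "tautology p \<longleftrightarrow> (\<forall>e. bool_eval e p)"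

definition normal_logic :: "'v fm set \<Rightarrow> bool" where
  "normal_logic L \<longleftrightarrow>
     (\<forall>p. tautology p \<longrightarrow> p \<in> L) \<and>
     (\<forall>p q. Imp (Box (Imp p q)) (Imp (Box p) (Box q)) \<in> L) \<and>
     (\<forall>p q. p \<in> L \<longrightarrow> Imp p q \<in> L \<longrightarrow> q \<in> L) \<and>
     (\<forall>p. p \<in> L \<longrightarrow> Box p \<in> L) \<and>
     (\<forall>p s. p \<in> L \<longrightarrow> subst_fm s p \<in> L)"

text \<open>In the next definitions the sequence $\varphi_0, \ldots, \varphi_n$ is given by the
  formula $\varphi_0$ and the list $[\varphi_1, \ldots, \varphi_n]$, so $n$ is the length of
  that list.\<close>

fun PP :: "'v fm \<Rightarrow> 'v fm list \<Rightarrow> 'v fm" where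
  "PP p0 [] = Dia p0"
| "PP p0 (p1 # ps) = Dia (And p1 (PP p0 ps))"

definition DD :: "'v fm \<Rightarrow> 'v fm list \<Rightarrow> 'v fm" where
  "DD p0 ps = (let qs = p0 # ps in
     Conj [Neg (And (qs ! i) (qs ! j)). j \<leftarrow> [0..<length qs], i \<leftarrow> [0..<j]])"

definition CC :: "'v fm \<Rightarrow> 'v fm list \<Rightarrow> 'v fm" where
  "CC p0 ps = Imp (BoxStar (DD p0 ps)) (Imp (Dia p0) (Dia (And p0 (Neg (PP p0 ps)))))"

definition K4C :: "nat \<Rightarrow> 'v fm set" where
  "K4C n = \<Inter> {L. normal_logic L \<and>
     (\<forall>p. Imp (Box p) (Box (Box p)) \<in> L) \<and>
     (\<forall>p0 ps. length ps = n \<longrightarrow> CC p0 ps \<in> L)}"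

text \<open>The empty frame is not excluded; it validates every formula, so this does not affect
  validity in a class of frames.\<close>

definition frame :: "'w set \<Rightarrow> ('w \<times> 'w) set \<Rightarrow> bool" where
  "frame W R \<longleftrightarrow> R \<subseteq> W \<times> W"

primrec holds_at ::
  "'w set \<Rightarrow> ('w \<times> 'w) set \<Rightarrow> ('v \<Rightarrow> 'w set) \<Rightarrow> 'w \<Rightarrow> 'v fm \<Rightarrow> bool" where
  "holds_at W R V x (Var v) = (x \<in> V v)"
| "holds_at W R V x Top = True"
| "holds_at W R V x (Neg p) = (\<not> holds_at W R V x p)"
| "holds_at W R V x (And p q) = (holds_at W R V x p \<and> holds_at W R V x q)"
| "holds_at W R V x (Box p) = (\<forall>y\<in>W. (x, y) \<in> R \<longrightarrow> holds_at W R V y p)"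

definition valid_in :: "'w set \<Rightarrow> ('w \<times> 'w) set \<Rightarrow> 'v fm \<Rightarrow> bool" where
  "valid_in W R p \<longleftrightarrow> (\<forall>V. (\<forall>v. V v \<subseteq> W) \<longrightarrow> (\<forall>x\<in>W. holds_at W R V x p))"

definition frame_cycle :: "'w set \<Rightarrow> ('w \<times> 'w) set \<Rightarrow> 'w list \<Rightarrow> bool" where
  "frame_cycle W R xs \<longleftrightarrow> xs \<noteq> [] \<and> distinct xs \<and> set xs \<subseteq> W \<and>
     (\<forall>i<length xs. (xs ! i, xs ! (Suc i mod length xs)) \<in> R)"

text \<open>The supremum is taken in \<open>enat\<close>, where the supremum of the empty set is 0.\<close>

definition circumference :: "'w set \<Rightarrow> ('w \<times> 'w) set \<Rightarrow> enat" where
  "circumference W R = (SUP xs\<in>{xs. frame_cycle W R xs}. enat (length xs))"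

definition strictly_ascending_chain ::
  "'w set \<Rightarrow> ('w \<times> 'w) set \<Rightarrow> (nat \<Rightarrow> 'w) \<Rightarrow> bool" where
  "strictly_ascending_chain W R x \<longleftrightarrow>
     (\<forall>m. x m \<in> W \<and> (x m, x (Suc m)) \<in> R \<and> (x (Suc m), x m) \<notin> R)"

text \<open>HOL cannot quantify over all types inside a formula, so the classes of frames consist of
  the frames whose points lie in a type \<open>'w\<close>. As \<open>'w\<close> is a type variable, a theorem about them
  ranges over all types. It has to be infinite, since otherwise finite frames of bounded size
  would be all there is; every frame is isomorphic to a frame over some infinite type.\<close>

definition valid_no_chains :: "'w itself \<Rightarrow> nat \<Rightarrow> 'v fm \<Rightarrow> bool" where
  "valid_no_chains _ n p \<longleftrightarrow>
     (\<forall>(W :: 'w set) R. frame W R \<longrightarrow> trans R \<longrightarrow> circumference W R \<le> enat n \<longrightarrow>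
        (\<nexists>x. strictly_ascending_chain W R x) \<longrightarrow> valid_in W R p)"

definition valid_finite :: "'w itself \<Rightarrow> nat \<Rightarrow> 'v fm \<Rightarrow> bool" where
  "valid_finite _ n p \<longleftrightarrow>
     (\<forall>(W :: 'w set) R. frame W R \<longrightarrow> finite W \<longrightarrow> trans R \<longrightarrow> circumference W R \<le> enat n \<longrightarrow>
        valid_in W R p)"

end

theory Submission
  imports Defs
begin

text \<open>Soundness uses a \<open>\<phi>\<^sub>0\<close>-successor that is maximal in the strict order. For completeness,
  let \<open>\<Sigma>\<close> be the finite set of subformulas of a non-theorem. By Zorn's lemma every successor in
  the canonical frame is matched by one of the same \<open>\<Sigma>\<close>-type that lies in a final cluster of
  points of that type. In a nondegenerate cluster of such points at most \<open>n\<close> types occur, since the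
  formulas defining \<open>n + 1\<close> distinct types would refute \<open>\<bbbC>\<^sub>n\<close>. Keeping one
  point for each cluster and type thus bounds the circumference, and since types cannot recur
  along strictly ascending paths, finitely many points suffice as witnesses for the boxed
  formulas in \<open>\<Sigma>\<close>.\<close>

section \<open>Truth of the derived connectives\<close>

lemma bool_eval_Imp [simp]: "bool_eval e (Imp p q) \<longleftrightarrow> (bool_eval e p \<longrightarrow> bool_eval e q)"
  by (auto simp: Imp_def)

lemma bool_eval_Conj [simp]: "bool_eval e (Conj ps) \<longleftrightarrow> (\<forall>p\<in>set ps. bool_eval e p)"
  by (induction ps) auto

lemma holds_at_Imp [simp]:
  "holds_at W R V x (Imp p q) \<longleftrightarrow> (holds_at W R V x p \<longrightarrow> holds_at W R V x q)"
  by (auto simp: Imp_def)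

lemma holds_at_Dia [simp]:
  "holds_at W R V x (Dia p) \<longleftrightarrow> (\<exists>y\<in>W. (x, y) \<in> R \<and> holds_at W R V y p)"
  by (auto simp: Dia_def)

lemma holds_at_Conj [simp]:
  "holds_at W R V x (Conj ps) \<longleftrightarrow> (\<forall>p\<in>set ps. holds_at W R V x p)"
  by (induction ps) auto

text \<open>The predicate \<open>Q\<close> stays abstract so that one unfolding of the list
  comprehension serves both Kripke truth and Boolean truth.\<close>

lemma ball_DD_conjuncts:
  "(\<forall>p\<in>set [Neg (And (qs ! i) (qs ! j)). j \<leftarrow> [0..<length qs], i \<leftarrow> [0..<j]]. Q p)
    \<longleftrightarrow> (\<forall>i j. i < j \<longrightarrow> j < length qs \<longrightarrow> Q (Neg (And (qs ! i) (qs ! j))))"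
proof -
  have *: "(\<forall>p\<in>set [f i j. j \<leftarrow> [0..<n], i \<leftarrow> [0..<j]]. Q p)
    \<longleftrightarrow> (\<forall>j<n. \<forall>i<j. Q (f i j))" for f :: "nat \<Rightarrow> nat \<Rightarrow> 'a fm" and n
    by (auto simp: atLeast0LessThan)
  show ?thesis unfolding * by blast
qed

lemma holds_at_DD:
  "holds_at W R V x (DD p0 ps) \<longleftrightarrow>
    (\<forall>i j. i < j \<longrightarrow> j < Suc (length ps) \<longrightarrow>
      \<not> (holds_at W R V x ((p0 # ps) ! i) \<and> holds_at W R V x ((p0 # ps) ! j)))"
  unfolding DD_def Let_def holds_at_Conj ball_DD_conjuncts by simp

lemma bool_eval_DD:
  "bool_eval e (DD p0 ps) \<longleftrightarrow>
    (\<forall>i j. i < j \<longrightarrow> j < Suc (length ps) \<longrightarrow>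
      \<not> (bool_eval e ((p0 # ps) ! i) \<and> bool_eval e ((p0 # ps) ! j)))"
  unfolding DD_def Let_def bool_eval_Conj ball_DD_conjuncts by simp

lemma circumference_le_iff:
  "circumference W R \<le> enat n \<longleftrightarrow> (\<forall>xs. frame_cycle W R xs \<longrightarrow> length xs \<le> n)"
  by (auto simp: circumference_def SUP_le_iff)

section \<open>Soundness\<close>

text \<open>Truth at a fixed point is itself a Boolean evaluation of the atoms, which makes
  tautologies true at every point.\<close>

lemma holds_at_bool_eval: "holds_at W R V x p \<longleftrightarrow> bool_eval (holds_at W R V x) p"
  by (induction p) auto

lemma holds_at_subst:
  "x \<in> W \<Longrightarrow>
    holds_at W R V x (subst_fm s p) \<longleftrightarrow> holds_at W R (\<lambda>v. {y \<in> W. holds_at W R V y (s v)}) x p"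
  by (induction p arbitrary: x) auto

lemma normal_logic_valid: "normal_logic {p. valid_in W R p}"
  unfolding normal_logic_def mem_Collect_eq
proof (intro conjI allI impI)
  fix p :: "'v fm" assume p: "tautology p"
  have "holds_at W R V x p" for V x
    using p holds_at_bool_eval[of W R V x p] by (simp add: tautology_def)
  then show "valid_in W R p" by (simp add: valid_in_def)
next
  fix p :: "'v fm" and s assume p: "valid_in W R p"
  show "valid_in W R (subst_fm s p)"
    unfolding valid_in_def
  proof (intro allI impI ballI)
    fix V x assume "x \<in> W"
    moreover have "holds_at W R (\<lambda>v. {y \<in> W. holds_at W R V y (s v)}) x p"
      by (rule p[unfolded valid_in_def, rule_format]) (use \<open>x \<in> W\<close> in auto)
    ultimately show "holds_at W R V x (subst_fm s p)"
      by (simp add: holds_at_subst)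
  qed
next
  fix p q :: "'v fm" assume "valid_in W R p" "valid_in W R (Imp p q)"
  then show "valid_in W R q" by (simp add: valid_in_def)
next
  fix p :: "'v fm" assume "valid_in W R p"
  then show "valid_in W R (Box p)" by (simp add: valid_in_def)
qed (simp add: valid_in_def)

lemma valid_four:
  assumes "trans R"
  shows "valid_in W R (Imp (Box p) (Box (Box p)))"
  using assms by (auto simp: valid_in_def dest: transD)

text \<open>Each diamond of \<open>PP\<close> contributes one step of a path. The endpoint
  \<open>z\<close> satisfies \<open>p0\<close> again, which later allows the path to be closed into
  a cycle.\<close>

lemma holds_at_PP_path:
  assumes "holds_at W R V y (PP p0 ps)"
  shows "\<exists>ys z. length ys = length ps \<and> set ys \<subseteq> W \<and> z \<in> W \<and>
    successively (\<lambda>a b. (a, b) \<in> R) (y # ys @ [z]) \<and>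
    (\<forall>i<length ps. holds_at W R V (ys ! i) (ps ! i)) \<and> holds_at W R V z p0"
  using assms
proof (induction ps arbitrary: y)
  case Nil
  then obtain z where "z \<in> W" "(y, z) \<in> R" "holds_at W R V z p0" by auto
  then show ?case by (intro exI[of _ "[]"] exI[of _ z]) auto
next
  case (Cons p ps)
  then obtain u where u: "u \<in> W" "(y, u) \<in> R" "holds_at W R V u p"
    "holds_at W R V u (PP p0 ps)" by auto
  from Cons.IH[OF u(4)] obtain ys z where "length ys = length ps" "set ys \<subseteq> W" "z \<in> W"
    "successively (\<lambda>a b. (a, b) \<in> R) (u # ys @ [z])"
    "\<forall>i<length ps. holds_at W R V (ys ! i) (ps ! i)" "holds_at W R V z p0" by blast
  with u show ?case
    by (intro exI[of _ "u # ys"] exI[of _ z]) (auto simp: nth_Cons split: nat.split)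
qed

lemma trans_successively_mem:
  assumes "trans R" "successively (\<lambda>a b. (a, b) \<in> R) (y # ys)" "u \<in> set ys"
  shows "(y, u) \<in> R"
  using assms
proof (induction ys arbitrary: y)
  case (Cons a ys)
  then show ?case by (auto dest: transD)
qed simp

text \<open>A \<open>\<phi>\<^sub>0\<close>-successor of \<open>x\<close> that is maximal in the strict order and satisfies
  \<open>\<bbbP>\<^sub>n\<close> would start a cycle of length \<open>n + 1\<close>.\<close>

lemma valid_CC:
  fixes W :: "'w set" and p0 :: "'v fm" and ps :: "'v fm list"
  assumes R: "trans R" and circ: "circumference W R \<le> enat (length ps)"
    and chains: "\<nexists>x. strictly_ascending_chain W R x"
  shows "valid_in W R (CC p0 ps)"
  unfolding valid_in_def
proof (intro allI impI ballI)
  fix V :: "'v \<Rightarrow> 'w set" and x assume "x \<in> W"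
  let ?h = "holds_at W R V"
  show "?h x (CC p0 ps)"
  proof (rule ccontr)
    assume "\<not> ?h x (CC p0 ps)"
    then have D: "\<And>u. u \<in> W \<Longrightarrow> (x, u) \<in> R \<Longrightarrow> ?h u (DD p0 ps)"
      and ex: "\<exists>y\<in>W. (x, y) \<in> R \<and> ?h y p0"
      and P: "\<And>y. y \<in> W \<Longrightarrow> (x, y) \<in> R \<Longrightarrow> ?h y p0 \<Longrightarrow> ?h y (PP p0 ps)"
      by (simp_all add: CC_def BoxStar_def)
    \<comment> \<open>\<open>S\<close> points downwards: its well-foundedness is the absence of
      strictly ascending chains, and an \<open>S\<close>-minimal point is maximal in the strict
      order.\<close>
    define S where "S = {(v, u). u \<in> W \<and> v \<in> W \<and> (u, v) \<in> R \<and> (v, u) \<notin> R}"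
    have "wf S"
      unfolding wf_iff_no_infinite_down_chain
    proof (rule notI)
      assume "\<exists>f. \<forall>i. (f (Suc i), f i) \<in> S"
      then obtain f where "\<And>i. (f (Suc i), f i) \<in> S" by blast
      then have "strictly_ascending_chain W R f"
        by (auto simp: strictly_ascending_chain_def S_def)
      then show False using chains by blast
    qed
    moreover from ex obtain y0 where "y0 \<in> {y \<in> W. (x, y) \<in> R \<and> ?h y p0}" by blast
    ultimately obtain y where y: "y \<in> W" "(x, y) \<in> R" "?h y p0"
      and max: "\<And>z. (z, y) \<in> S \<Longrightarrow> z \<notin> {y \<in> W. (x, y) \<in> R \<and> ?h y p0}"
      by (rule wfE_min) blast
    obtain ys z where ys: "length ys = length ps" "set ys \<subseteq> W" "z \<in> W"
      "successively (\<lambda>a b. (a, b) \<in> R) (y # ys @ [z])"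
      "\<And>i. i < length ps \<Longrightarrow> ?h (ys ! i) (ps ! i)" "?h z p0"
      using holds_at_PP_path[OF P[OF y]] by blast
    have above: "(y, u) \<in> R" if "u \<in> set (ys @ [z])" for u
      using trans_successively_mem[OF R ys(4) that] .
    then have "(x, z) \<in> R" using y(2) R by (auto dest: transD)
    \<comment> \<open>\<open>z\<close> is a \<open>p0\<close>-successor of \<open>x\<close> above
      \<open>y\<close>, so by maximality it is not strictly above \<open>y\<close>.\<close>
    then have zy: "(z, y) \<in> R"
      using max[of z] ys(3,6) y(1) above[of z] by (auto simp: S_def)
    let ?xs = "y # ys"
    have sees: "(x, u) \<in> R" if "u \<in> set ?xs" for u
      using that y(2) above R by (auto dest: transD)
    have h: "?h (?xs ! i) ((p0 # ps) ! i)" if "i < length ?xs" for i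
      using that y(3) ys(1,5) by (cases i) auto
    \<comment> \<open>A repeated point would satisfy two of the formulas that \<open>DD\<close>
      makes exclusive at every successor of \<open>x\<close>.\<close>
    have "?xs ! i \<noteq> ?xs ! j" if "i < j" "j < length ?xs" for i j
    proof
      assume eq: "?xs ! i = ?xs ! j"
      have mem: "?xs ! j \<in> set ?xs" using that(2) by (rule nth_mem)
      then have "?h (?xs ! j) (DD p0 ps)"
        using D[OF _ sees[OF mem]] y(1) ys(2) by auto
      moreover have "?h (?xs ! j) ((p0 # ps) ! i)" using h[of i] that eq by simp
      ultimately show False
        using h[OF that(2)] that ys(1) by (auto simp: holds_at_DD)
    qed
    then have "distinct ?xs"
      unfolding distinct_conv_nth by (metis linorder_neqE_nat)
    moreover have "(?xs ! i, ?xs ! (Suc i mod length ?xs)) \<in> R" if i: "i < length ?xs" for i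
    proof (cases "Suc i < length ?xs")
      case True
      have "((y # ys @ [z]) ! i, (y # ys @ [z]) ! Suc i) \<in> R"
        using ys(4) True by (auto simp: successively_conv_nth)
      with True show ?thesis by (auto simp: nth_append nth_Cons split: nat.splits)
    next
      \<comment> \<open>The closing step leads through \<open>z\<close> back to \<open>y\<close>.
        For empty \<open>ys\<close> this yields the loop at \<open>y\<close>, a cycle of length
        1.\<close>
      case False
      then have *: "i = length ys" using i by simp
      have "((y # ys @ [z]) ! i, (y # ys @ [z]) ! Suc i) \<in> R"
        using ys(4) * by (auto simp: successively_conv_nth)
      then have "(?xs ! i, z) \<in> R"
        using * by (auto simp: nth_append nth_Cons split: nat.splits)
      then show ?thesis using zy R * by (auto dest: transD)
    qed
    ultimately have "frame_cycle W R ?xs"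
      using y(1) ys(2) by (simp add: frame_cycle_def)
    then show False
      using circ ys(1) by (auto simp: circumference_le_iff)
  qed
qed

lemma K4C_sound:
  assumes "p \<in> K4C n" "trans R" "circumference W R \<le> enat n"
    "\<nexists>x. strictly_ascending_chain W R x"
  shows "valid_in W R p"
proof -
  have "{p. valid_in W R p} \<in> {L. normal_logic L \<and>
     (\<forall>p. Imp (Box p) (Box (Box p)) \<in> L) \<and> (\<forall>p0 ps. length ps = n \<longrightarrow> CC p0 ps \<in> L)}"
    using normal_logic_valid valid_four valid_CC assms(2-4) by blast
  then show ?thesis using assms(1) unfolding K4C_def by blast
qed

text \<open>A chain in a finite set revisits some point \<open>x i\<close>, and transitivity then
  leads from \<open>x (Suc i)\<close> back to it, against strictness.\<close>

lemma finite_no_ascending_chain: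
  assumes "finite W" "trans R"
  shows "\<not> strictly_ascending_chain W R x"
proof
  assume x: "strictly_ascending_chain W R x"
  then have "range x \<subseteq> W" by (auto simp: strictly_ascending_chain_def)
  then have "\<not> inj x" using assms(1) finite_subset range_inj_infinite by blast
  then obtain i j where ij: "i < j" "x i = x j"
    unfolding inj_on_def by (metis linorder_neqE_nat)
  have "x (Suc i) = x (Suc i + d) \<or> (x (Suc i), x (Suc i + d)) \<in> R" for d
  proof (induction d)
    case (Suc d)
    have "(x (Suc i + d), x (Suc i + Suc d)) \<in> R"
      using x by (simp add: strictly_ascending_chain_def)
    with Suc show ?case using assms(2) by (metis transD)
  qed simp
  from this[of "j - Suc i"] have "x (Suc i) = x i \<or> (x (Suc i), x i) \<in> R"
    using ij by simp
  moreover have "(x i, x (Suc i)) \<in> R" "(x (Suc i), x i) \<notin> R"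
    using x by (auto simp: strictly_ascending_chain_def)
  ultimately show False by auto
qed

section \<open>Canonical models\<close>

text \<open>The canonical model is built over K4 alone; the scheme \<open>CC\<close> enters as a
  separate assumption where clusters are bounded.\<close>

locale k4_logic =
  fixes L :: "'v fm set"
  assumes taut: "tautology p \<Longrightarrow> p \<in> L"
    and K: "Imp (Box (Imp p q)) (Imp (Box p) (Box q)) \<in> L"
    and mp: "p \<in> L \<Longrightarrow> Imp p q \<in> L \<Longrightarrow> q \<in> L"
    and nec: "p \<in> L \<Longrightarrow> Box p \<in> L"
    and four: "Imp (Box p) (Box (Box p)) \<in> L"
begin

lemma taut_mp:
  assumes "p \<in> L" "\<And>e. bool_eval e p \<Longrightarrow> bool_eval e q"
  shows "q \<in> L"
  using mp[OF assms(1) taut[of "Imp p q"]] assms(2) by (auto simp: tautology_def)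

lemma taut_mp2:
  assumes "p \<in> L" "q \<in> L" "\<And>e. bool_eval e p \<Longrightarrow> bool_eval e q \<Longrightarrow> bool_eval e r"
  shows "r \<in> L"
  using mp[OF assms(2) taut_mp[OF assms(1), of "Imp q r"]] assms(3) by auto

section \<open>Maximal consistent sets\<close>

definition consistent :: "'v fm set \<Rightarrow> bool" where
  "consistent S \<longleftrightarrow> (\<forall>ps. set ps \<subseteq> S \<longrightarrow> Neg (Conj ps) \<notin> L)"

definition mcs :: "'v fm set \<Rightarrow> bool" where
  "mcs S \<longleftrightarrow> consistent S \<and> (\<forall>T. consistent T \<longrightarrow> S \<subseteq> T \<longrightarrow> T = S)"

text \<open>Zorn's lemma applies because consistency is finitary: finitely many formulas from the
  union of a nonempty chain already lie in one member.\<close>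

lemma lindenbaum:
  assumes "consistent S"
  shows "\<exists>T. S \<subseteq> T \<and> mcs T"
proof -
  let ?A = "{T. S \<subseteq> T \<and> consistent T}"
  have "\<exists>M\<in>?A. \<forall>X\<in>?A. M \<subseteq> X \<longrightarrow> X = M"
  proof (rule subset_Zorn_nonempty)
    show "?A \<noteq> {}" using assms by blast
  next
    fix C assume C: "C \<noteq> {}" "subset.chain ?A C"
    have "consistent (\<Union>C)"
      unfolding consistent_def
    proof (intro allI impI)
      fix ps assume "set ps \<subseteq> \<Union>C"
      then obtain T where "T \<in> C" "set ps \<subseteq> T"
        using finite_subset_Union_chain[of "set ps" C ?A] C by auto
      with C show "Neg (Conj ps) \<notin> L"
        by (auto simp: subset_chain_def consistent_def)
    qed
    then show "\<Union>C \<in> ?A" using C unfolding subset_chain_def by blast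
  qed
  then obtain M where M: "S \<subseteq> M" "consistent M"
    "\<And>X. S \<subseteq> X \<Longrightarrow> consistent X \<Longrightarrow> M \<subseteq> X \<Longrightarrow> X = M" by auto
  then have "mcs M" unfolding mcs_def by blast
  with M(1) show ?thesis by blast
qed

lemma inconsistent_insertE:
  assumes "\<not> consistent (insert p S)"
  obtains rs where "set rs \<subseteq> S" "Imp (Conj rs) (Neg p) \<in> L"
proof -
  from assms obtain ps where ps: "set ps \<subseteq> insert p S" "Neg (Conj ps) \<in> L"
    by (auto simp: consistent_def)
  let ?rs = "filter (\<lambda>q. q \<noteq> p) ps"
  have "Imp (Conj ?rs) (Neg p) \<in> L"
    by (rule taut_mp[OF ps(2)]) auto
  moreover have "set ?rs \<subseteq> S" using ps(1) by auto
  ultimately show thesis by (rule that[rotated])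
qed

lemma mcs_closed:
  assumes "mcs S" "set ps \<subseteq> S" "Imp (Conj ps) p \<in> L"
  shows "p \<in> S"
proof -
  have "consistent (insert p S)"
  proof (rule ccontr)
    assume "\<not> consistent (insert p S)"
    then obtain rs where rs: "set rs \<subseteq> S" "Imp (Conj rs) (Neg p) \<in> L"
      by (rule inconsistent_insertE)
    have "Neg (Conj (ps @ rs)) \<in> L"
      by (rule taut_mp2[OF rs(2) assms(3)]) auto
    moreover have "set (ps @ rs) \<subseteq> S" using assms(2) rs(1) by simp
    ultimately show False using assms(1) unfolding mcs_def consistent_def by blast
  qed
  then show ?thesis using assms(1) unfolding mcs_def by blast
qed

lemma mcs_taut:
  assumes "mcs S" "set ps \<subseteq> S" "\<And>e. \<forall>p\<in>set ps. bool_eval e p \<Longrightarrow> bool_eval e q"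
  shows "q \<in> S"
  using assms by (intro mcs_closed[OF assms(1,2)] taut) (auto simp: tautology_def)

lemma mcs_L:
  assumes "mcs S" "p \<in> L"
  shows "p \<in> S"
  by (rule mcs_closed[of _ "[]"]) (auto intro!: taut_mp[OF assms(2)] assms(1))

lemma mcs_mp:
  assumes "mcs S" "Imp p q \<in> S" "p \<in> S"
  shows "q \<in> S"
  by (rule mcs_taut[of _ "[p, Imp p q]"]) (use assms in auto)

lemma mcs_Neg [simp]:
  assumes "mcs S"
  shows "Neg p \<in> S \<longleftrightarrow> p \<notin> S"
proof
  assume "Neg p \<in> S"
  have "Neg (Conj [p, Neg p]) \<in> L" by (rule taut) (auto simp: tautology_def)
  with \<open>Neg p \<in> S\<close> show "p \<notin> S"
    using assms unfolding mcs_def consistent_def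
    by (metis empty_set empty_subsetI insert_subset list.simps(15))
next
  assume "p \<notin> S"
  then have "\<not> consistent (insert p S)" using assms unfolding mcs_def by blast
  then obtain rs where "set rs \<subseteq> S" "Imp (Conj rs) (Neg p) \<in> L"
    by (rule inconsistent_insertE)
  then show "Neg p \<in> S" using assms mcs_closed by blast
qed

lemma mcs_And [simp]:
  assumes "mcs S"
  shows "And p q \<in> S \<longleftrightarrow> p \<in> S \<and> q \<in> S"
proof (intro iffI conjI)
  show "p \<in> S" if "And p q \<in> S" by (rule mcs_taut[OF assms, of "[And p q]"]) (use that in auto)
  show "q \<in> S" if "And p q \<in> S" by (rule mcs_taut[OF assms, of "[And p q]"]) (use that in auto)
  show "And p q \<in> S" if "p \<in> S \<and> q \<in> S" by (rule mcs_taut[OF assms, of "[p, q]"]) (use that in auto)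
qed

lemma mcs_Top [simp]: "mcs S \<Longrightarrow> Top \<in> S"
  by (rule mcs_taut[of _ "[]"]) auto

lemma mcs_Conj [simp]: "mcs S \<Longrightarrow> Conj ps \<in> S \<longleftrightarrow> set ps \<subseteq> S"
  by (induction ps) auto

text \<open>The axiom \<open>K\<close> is applied once per conjunct; \<open>p\<close> is generalised
  because the induction moves \<open>r\<close> into the conclusion as
  \<open>Imp r p\<close>.\<close>

lemma mcs_Box_Conj:
  assumes "mcs x" "\<forall>r\<in>set rs. Box r \<in> x" "Imp (Conj rs) p \<in> L"
  shows "Box p \<in> x"
  using assms(2,3)
proof (induction rs arbitrary: p)
  case Nil
  then have "p \<in> L" by (auto intro: taut_mp)
  then show ?case using assms(1) nec mcs_L by blast
next
  case (Cons r rs)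
  have "Imp (Conj rs) (Imp r p) \<in> L" by (rule taut_mp[OF Cons.prems(2)]) auto
  then have "Box (Imp r p) \<in> x" using Cons by simp
  then show ?case using mcs_mp[OF assms(1)] mcs_L[OF assms(1) K] Cons.prems(1)
    by (metis list.set_intros(1))
qed

section \<open>The canonical frame and its maximal points\<close>

definition canon :: "('v fm set \<times> 'v fm set) set" where
  "canon = {(x, y). mcs x \<and> mcs y \<and> (\<forall>p. Box p \<in> x \<longrightarrow> p \<in> y)}"

lemma canonD: "(x, y) \<in> canon \<Longrightarrow> Box p \<in> x \<Longrightarrow> p \<in> y"
  and canon_mcs1: "(x, y) \<in> canon \<Longrightarrow> mcs x"
  and canon_mcs2: "(x, y) \<in> canon \<Longrightarrow> mcs y"
  by (auto simp: canon_def)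

lemma mcs_Box_Box: "mcs x \<Longrightarrow> Box p \<in> x \<Longrightarrow> Box (Box p) \<in> x"
  using mcs_L[OF _ four] mcs_mp by blast

lemma canon_Box: "(x, y) \<in> canon \<Longrightarrow> Box p \<in> x \<Longrightarrow> Box p \<in> y"
  using canonD canon_mcs1 mcs_Box_Box by blast

lemma trans_canon: "trans canon"
proof (rule transI)
  fix x y z assume xy: "(x, y) \<in> canon" and yz: "(y, z) \<in> canon"
  have "p \<in> z" if "Box p \<in> x" for p
    using canonD[OF yz canon_Box[OF xy that]] .
  then show "(x, z) \<in> canon"
    using canon_mcs1[OF xy] canon_mcs2[OF yz] by (simp add: canon_def)
qed

lemma canon_Box_iff:
  assumes "mcs x"
  shows "Box p \<in> x \<longleftrightarrow> (\<forall>y. (x, y) \<in> canon \<longrightarrow> p \<in> y)"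
proof
  show "\<forall>y. (x, y) \<in> canon \<longrightarrow> p \<in> y" if "Box p \<in> x" using that canonD by blast
next
  assume *: "\<forall>y. (x, y) \<in> canon \<longrightarrow> p \<in> y"
  show "Box p \<in> x"
  proof (rule ccontr)
    assume "Box p \<notin> x"
    \<comment> \<open>Otherwise finitely many formulas boxed in \<open>x\<close> imply
      \<open>p\<close>, and necessitation with \<open>K\<close> puts \<open>Box p\<close> into
      \<open>x\<close>.\<close>
    have "consistent (insert (Neg p) {q. Box q \<in> x})"
    proof (rule ccontr)
      assume "\<not> ?thesis"
      then obtain rs where rs: "set rs \<subseteq> {q. Box q \<in> x}" "Imp (Conj rs) (Neg (Neg p)) \<in> L"
        by (rule inconsistent_insertE)
      have "Imp (Conj rs) p \<in> L" by (rule taut_mp[OF rs(2)]) auto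
      then show False using mcs_Box_Conj[OF assms] rs(1) \<open>Box p \<notin> x\<close> by blast
    qed
    then obtain y where "insert (Neg p) {q. Box q \<in> x} \<subseteq> y" "mcs y"
      using lindenbaum by blast
    then have "(x, y) \<in> canon" "p \<notin> y" using assms by (auto simp: canon_def)
    with * show False by blast
  qed
qed

lemma canon_Dia_iff: "mcs x \<Longrightarrow> Dia p \<in> x \<longleftrightarrow> (\<exists>y. (x, y) \<in> canon \<and> p \<in> y)"
  unfolding Dia_def using canon_Box_iff canon_mcs2 mcs_Neg by metis

text \<open>All \<open>p\<close>-successors of \<open>y\<close> lie in its cluster. A point without
  \<open>p\<close>-successors qualifies vacuously, so irreflexive points are covered.\<close>

definition maximal_for :: "'v fm \<Rightarrow> 'v fm set \<Rightarrow> bool" where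
  "maximal_for p y \<longleftrightarrow> (\<forall>z. (y, z) \<in> canon \<longrightarrow> p \<in> z \<longrightarrow> (z, y) \<in> canon)"

text \<open>Zorn's lemma is applied to the sets of boxed members of the \<open>p\<close>-successors of \<open>x\<close>. A
  \<open>p\<close>-successor whose set is maximal need not be reflexive, but if it is not maximal in the
  sense wanted then each of its \<open>p\<close>-successors is.\<close>

lemma exists_maximal_for:
  assumes xy0: "(x, y0) \<in> canon" "p \<in> y0"
  shows "\<exists>y. (x, y) \<in> canon \<and> p \<in> y \<and> maximal_for p y"
proof -
  \<comment> \<open>By axiom 4, \<open>boxes\<close> grows along \<open>canon\<close>. Conversely,
    if \<open>boxes w\<close> is included in \<open>boxes y\<close>, then \<open>w\<close> sees
    every successor of \<open>y\<close>.\<close>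
  define boxes :: "'v fm set \<Rightarrow> 'v fm set" where "boxes y = y \<inter> range Box" for y
  define U where "U = {y. (x, y) \<in> canon \<and> p \<in> y}"
  have "\<exists>M\<in>boxes ` U. \<forall>X\<in>boxes ` U. M \<subseteq> X \<longrightarrow> X = M"
  proof (rule subset_Zorn)
    fix C assume C: "subset.chain (boxes ` U) C"
    show "\<exists>B\<in>boxes ` U. \<forall>X\<in>C. X \<subseteq> B"
    proof (cases "C = {}")
      case True
      then show ?thesis using xy0 unfolding U_def by blast
    next
      case False
      \<comment> \<open>Any maximal consistent extension of \<open>?S\<close> is a
        \<open>p\<close>-successor of \<open>x\<close> and contains every member of the chain.
        Consistency holds because finitely many members of \<open>?S\<close> lie in a single point
        of \<open>U\<close>.\<close>
      let ?S = "\<Union>C \<union> insert p {q. Box q \<in> x}"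
      have "consistent ?S"
        unfolding consistent_def
      proof (intro allI impI)
        fix ps assume ps: "set ps \<subseteq> ?S"
        let ?qs = "filter (\<lambda>q. q \<in> \<Union>C) ps"
        have "set ?qs \<subseteq> \<Union>C" by auto
        then obtain T where T: "T \<in> C" "set ?qs \<subseteq> T"
          using finite_subset_Union_chain[of "set ?qs" C] C False by auto
        then obtain y where y: "y \<in> U" "T = boxes y" using C by (auto simp: subset_chain_def)
        have "(x, y) \<in> canon" "p \<in> y" using y(1) by (auto simp: U_def)
        then have "insert p {q. Box q \<in> x} \<subseteq> y" using canonD by blast
        moreover have "set ?qs \<subseteq> y" using T(2) y(2) unfolding boxes_def by blast
        moreover have "set ps \<subseteq> set ?qs \<union> insert p {q. Box q \<in> x}" using ps by auto
        ultimately have "set ps \<subseteq> y" by (meson Un_least subset_trans)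
        moreover have "mcs y" using y canon_mcs2 by (auto simp: U_def)
        ultimately show "Neg (Conj ps) \<notin> L" unfolding mcs_def consistent_def by blast
      qed
      then obtain w where w: "?S \<subseteq> w" "mcs w" using lindenbaum by blast
      then have "w \<in> U"
        using canon_mcs1[OF xy0(1)] by (auto simp: U_def canon_def)
      moreover have "X \<subseteq> boxes w" if X: "X \<in> C" for X
      proof -
        have "C \<subseteq> boxes ` U" using C by (simp add: subset_chain_def)
        then obtain y where "X = boxes y" using X by blast
        moreover have "X \<subseteq> w"
          by (rule subset_trans[OF Union_upper[OF X]]) (use w(1) in simp)
        ultimately show ?thesis unfolding boxes_def by blast
      qed
      ultimately show ?thesis by blast
    qed
  qed
  then obtain y where y: "y \<in> U" and max: "\<And>z. z \<in> U \<Longrightarrow> boxes y \<subseteq> boxes z \<Longrightarrow> boxes z = boxes y"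
    by blast
  have up: "z \<in> U \<and> boxes z = boxes y" if "(y, z) \<in> canon" "p \<in> z" for z
  proof -
    have "z \<in> U" using that y transD[OF trans_canon] unfolding U_def by blast
    moreover have "boxes y \<subseteq> boxes z"
      using canon_Box[OF that(1)] by (auto simp: boxes_def)
    ultimately show ?thesis using max by blast
  qed
  show ?thesis
  proof (cases "maximal_for p y")
    case True
    with y show ?thesis by (auto simp: U_def)
  next
    case False
    then obtain z where z: "(y, z) \<in> canon" "p \<in> z" by (auto simp: maximal_for_def)
    have "maximal_for p z"
      unfolding maximal_for_def
    proof (intro allI impI)
      fix w assume w: "(z, w) \<in> canon" "p \<in> w"
      then have "(y, w) \<in> canon" using z transD[OF trans_canon] by blast
      then have "boxes w = boxes y" using up w by blast
      then have "\<forall>q. Box q \<in> w \<longrightarrow> Box q \<in> y" by (auto simp: boxes_def)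
      then have "q \<in> z" if "Box q \<in> w" for q using that canonD[OF z(1)] by blast
      then show "(w, z) \<in> canon"
        using canon_mcs1[OF w(1)] canon_mcs2[OF w(1)] by (simp add: canon_def)
    qed
    then show ?thesis using up[OF z] z by (auto simp: U_def)
  qed
qed

text \<open>Within a cluster every diamond of \<open>PP\<close> can be met by moving to whichever
  point contains the formula required next.\<close>

lemma cluster_PP:
  assumes "\<And>a b. a \<in> C \<Longrightarrow> b \<in> C \<Longrightarrow> (a, b) \<in> canon"
    and "\<And>q. q \<in> insert p0 (set ps) \<Longrightarrow> \<exists>c\<in>C. q \<in> c" and "z \<in> C"
  shows "PP p0 ps \<in> z"
  using assms(2,3)
proof (induction ps arbitrary: z)
  case Nil
  have "mcs z" using assms(1)[OF Nil(2) Nil(2)] by (rule canon_mcs1)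
  with Nil show ?case using assms(1) by (auto simp: canon_Dia_iff)
next
  case (Cons q ps)
  obtain c where c: "c \<in> C" "q \<in> c" using Cons.prems(1)[of q] by auto
  have m: "mcs z" "mcs c" using assms(1) Cons.prems(2) c(1) canon_mcs1 by blast+
  have "PP p0 ps \<in> c" using Cons.IH[of c] Cons.prems c by auto
  then have "And q (PP p0 ps) \<in> c" using m c by simp
  moreover have "(z, c) \<in> canon" using assms(1) Cons.prems(2) c(1) by blast
  ultimately show ?case using canon_Dia_iff[OF m(1)] by auto
qed

end

section \<open>Types over a finite set of formulas\<close>

text \<open>The characteristic formula of the type of \<open>x\<close> over \<open>qs\<close>; it
  depends on \<open>x\<close> only through \<open>x \<inter> set qs\<close>.\<close>

definition type_fm :: "'v fm list \<Rightarrow> 'v fm set \<Rightarrow> 'v fm" where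
  "type_fm qs x = Conj (map (\<lambda>q. if q \<in> x then q else Neg q) qs)"

lemma type_fm_exclusive:
  assumes "x \<inter> set qs \<noteq> y \<inter> set qs"
  shows "\<not> (bool_eval e (type_fm qs x) \<and> bool_eval e (type_fm qs y))"
proof -
  have *: "bool_eval e (type_fm qs z) \<longleftrightarrow> (\<forall>q\<in>set qs. bool_eval e q \<longleftrightarrow> q \<in> z)" for z
    by (induction qs) (simp_all add: type_fm_def)
  obtain q where "q \<in> set qs" "(q \<in> x) \<noteq> (q \<in> y)" using assms by blast
  then show ?thesis unfolding * by blast
qed

text \<open>Distinct types disagree on some member of \<open>qs\<close>, so their formulas exclude
  each other propositionally. The premise of \<open>CC\<close> is thus a theorem for them.\<close>

lemma DD_types_tautology:
  assumes "distinct (map (\<lambda>x. x \<inter> set qs) (x # xs))"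
  shows "tautology (DD (type_fm qs x) (map (type_fm qs) xs))"
  unfolding tautology_def bool_eval_DD
proof (intro allI impI)
  fix e i j assume ij: "i < j" "j < Suc (length (map (type_fm qs) xs))"
  have eq: "(type_fm qs x # map (type_fm qs) xs) ! k = type_fm qs ((x # xs) ! k)"
    if "k \<le> j" for k using that ij by (cases k) auto
  have "(x # xs) ! i \<inter> set qs \<noteq> (x # xs) ! j \<inter> set qs"
    using assms ij nth_eq_iff_index_eq[of "map (\<lambda>x. x \<inter> set qs) (x # xs)" i j]
      nth_map[of i "x # xs" "\<lambda>x. x \<inter> set qs"] nth_map[of j "x # xs" "\<lambda>x. x \<inter> set qs"]
    by auto
  then show "\<not> (bool_eval e ((type_fm qs x # map (type_fm qs) xs) ! i) \<and>
      bool_eval e ((type_fm qs x # map (type_fm qs) xs) ! j))"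
    using type_fm_exclusive eq ij(1) by (metis less_imp_le_nat order_refl)
qed

lemma (in k4_logic) mcs_type_fm: "mcs y \<Longrightarrow> type_fm qs x \<in> y \<longleftrightarrow> y \<inter> set qs = x \<inter> set qs"
  by (auto simp: type_fm_def image_subset_iff split: if_splits)

text \<open>For \<open>n + 1\<close> types, \<open>CC\<close> gives a point \<open>z\<close> of the
  first type where \<open>PP\<close> fails. Maximality puts \<open>z\<close> back into the cluster,
  where \<open>cluster_PP\<close> makes \<open>PP\<close> true.\<close>

lemma (in k4_logic) canon_cluster_types:
  assumes CC: "\<And>p0 ps. length ps = n \<Longrightarrow> CC p0 ps \<in> L"
    and cluster: "\<And>a b. a \<in> set xs \<Longrightarrow> b \<in> set xs \<Longrightarrow> (a, b) \<in> canon"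
    and max: "\<And>x. x \<in> set xs \<Longrightarrow> maximal_for (type_fm qs x) x"
    and dist: "distinct (map (\<lambda>x. x \<inter> set qs) xs)"
  shows "length xs \<le> n"
proof (rule ccontr)
  assume "\<not> length xs \<le> n"
  then obtain x ys where ys: "take (Suc n) xs = x # ys" "length ys = n"
    by (cases xs) auto
  have sub: "set (x # ys) \<subseteq> set xs" unfolding ys(1)[symmetric] by (rule set_take_subset)
  let ?p = "type_fm qs x" and ?ps = "map (type_fm qs) ys"
  have xx: "(x, x) \<in> canon" using cluster sub by simp
  then have x: "mcs x" by (rule canon_mcs1)
  have "distinct (map (\<lambda>x. x \<inter> set qs) (x # ys))"
    unfolding ys(1)[symmetric] take_map[symmetric] using dist by (rule distinct_take)
  then have D: "DD ?p ?ps \<in> L" by (intro taut DD_types_tautology)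
  then have "BoxStar (DD ?p ?ps) \<in> x" using x nec mcs_L by (simp add: BoxStar_def)
  moreover have "Dia ?p \<in> x" using x xx by (auto simp: canon_Dia_iff mcs_type_fm)
  moreover have "CC ?p ?ps \<in> x" using x CC mcs_L ys(2) by simp
  ultimately have "Dia (And ?p (Neg (PP ?p ?ps))) \<in> x"
    unfolding CC_def using mcs_mp[OF x] by blast
  then obtain z where z: "(x, z) \<in> canon" "?p \<in> z" "PP ?p ?ps \<notin> z"
    using x canon_mcs2 by (auto simp: canon_Dia_iff)
  then have zx: "(z, x) \<in> canon" using max sub by (auto simp: maximal_for_def)
  have "PP ?p ?ps \<in> z"
  \<comment> \<open>\<open>z\<close> may be a new point, so it is adjoined to the cluster;
    \<open>x\<close> connects it with all the others in both directions.\<close>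
  proof (rule cluster_PP[of "insert z (set xs)"])
    fix a b assume ab: "a \<in> insert z (set xs)" "b \<in> insert z (set xs)"
    have "x \<in> set xs" using sub by simp
    then have "(a, x) \<in> canon" "(x, b) \<in> canon" using ab z(1) zx cluster by auto
    then show "(a, b) \<in> canon" using trans_canon by (auto dest: transD)
  next
    fix q assume "q \<in> insert ?p (set ?ps)"
    then obtain u where "u \<in> set xs" "q = type_fm qs u" using sub by auto
    moreover from this have "mcs u" using cluster canon_mcs1 by blast
    ultimately show "\<exists>c\<in>insert z (set xs). q \<in> c"
      by (intro bexI[of _ u]) (auto simp: mcs_type_fm)
  qed simp
  with z(3) show False by contradiction
qed

section \<open>Finite submodels\<close>

text \<open>Induction on the number of types at or above \<open>y\<close>, which drops at each
  strict step. One witness per type is kept in the cluster of \<open>y\<close>, and one per type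
  strictly above it together with its own selection.\<close>

lemma finite_selection:
  assumes R: "trans R" and fin: "finite (tp ` M)"
    and max: "\<And>y z. y \<in> M \<Longrightarrow> z \<in> M \<Longrightarrow> (y, z) \<in> R \<Longrightarrow> tp z = tp y \<Longrightarrow> (z, y) \<in> R"
    and "y \<in> M"
  shows "\<exists>F\<subseteq>M. finite F \<and> y \<in> F \<and>
    (\<forall>z\<in>F. \<forall>w\<in>M. (z, w) \<in> R \<longrightarrow> (\<exists>w'\<in>F. (z, w') \<in> R \<and> tp w' = tp w))"
  using \<open>y \<in> M\<close>
proof (induction "card (tp ` {w \<in> M. w = y \<or> (y, w) \<in> R})" arbitrary: y rule: less_induct)
  case less
  let ?N = "\<lambda>y. {w \<in> M. w = y \<or> (y, w) \<in> R}"
  let ?P = "\<lambda>F. F \<subseteq> M \<and> finite F \<and>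
    (\<forall>z\<in>F. \<forall>w\<in>M. (z, w) \<in> R \<longrightarrow> (\<exists>w'\<in>F. (z, w') \<in> R \<and> tp w' = tp w))"
  have tR: "(a, c) \<in> R" if "(a, b) \<in> R" "(b, c) \<in> R" for a b c
    using R that by (auto dest: transD)
  define C where "C = {w \<in> M. (y, w) \<in> R \<and> (w, y) \<in> R}"
  define S where "S = {w \<in> M. (y, w) \<in> R \<and> (w, y) \<notin> R}"
  have IH: "\<exists>F. ?P F \<and> z \<in> F" if z: "z \<in> S" for z
  proof -
    have zz: "z \<in> M" "(y, z) \<in> R" "(z, y) \<notin> R" using z by (auto simp: S_def)
    \<comment> \<open>A point of the type of \<open>y\<close> at or above \<open>z\<close> would see
      \<open>y\<close> by \<open>max\<close>, so \<open>z\<close> would see \<open>y\<close>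
      too.\<close>
    have "tp y \<notin> tp ` ?N z"
    proof
      assume "tp y \<in> tp ` ?N z"
      then obtain w where w: "w \<in> M" "w = z \<or> (z, w) \<in> R" "tp w = tp y" by auto
      then have "(y, w) \<in> R" using zz tR by blast
      then have "(w, y) \<in> R" using max less.prems w by blast
      then show False using w zz tR by blast
    qed
    moreover have "tp y \<in> tp ` ?N y" using less.prems by auto
    moreover have "?N z \<subseteq> ?N y" using zz tR by blast
    ultimately have "tp ` ?N z \<subset> tp ` ?N y" by blast
    then have "card (tp ` ?N z) < card (tp ` ?N y)"
      by (rule psubset_card_mono[rotated]) (rule finite_subset[OF _ fin], auto)
    from less.hyps[OF this zz(1)] show ?thesis by blast
  qed
  then obtain G where G: "\<And>z. z \<in> S \<Longrightarrow> ?P (G z) \<and> z \<in> G z" by metis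
  have "finite (tp ` C)" "finite (tp ` S)"
    by (rule finite_subset[OF _ fin], auto simp: C_def S_def)+
  then obtain A B where A: "A \<subseteq> C" "finite A" "tp ` C = tp ` A"
    and B: "B \<subseteq> S" "finite B" "tp ` S = tp ` B"
    by (metis finite_subset_image subset_refl)
  let ?F = "insert y A \<union> (\<Union>z\<in>B. G z)"
  have "\<exists>w'\<in>?F. (z, w') \<in> R \<and> tp w' = tp w"
    if z: "z \<in> ?F" and w: "w \<in> M" "(z, w) \<in> R" for z w
  proof (cases "z \<in> insert y A")
    case True
    \<comment> \<open>Points of \<open>A\<close> are in the cluster of \<open>y\<close> and have the
      same successors, so the witnesses chosen for \<open>y\<close> serve them too.\<close>
    then have zy: "z = y \<or> (y, z) \<in> R \<and> (z, y) \<in> R" using A(1) by (auto simp: C_def)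
    then have yw: "(y, w) \<in> R" using w tR by blast
    show ?thesis
    proof (cases "(w, y) \<in> R")
      case True
      then have "tp w \<in> tp ` A" using A(3) w yw by (auto simp: C_def)
      then obtain a where a: "a \<in> A" "tp a = tp w" by auto
      then have "(z, a) \<in> R" using zy A(1) tR by (auto simp: C_def)
      with a show ?thesis by auto
    next
      case False
      then have "tp w \<in> tp ` B" using B(3) w yw by (auto simp: S_def)
      then obtain b where b: "b \<in> B" "tp b = tp w" by auto
      then have "b \<in> S" using B(1) by blast
      then have "(y, b) \<in> R" "b \<in> G b" using G[of b] by (simp_all add: S_def)
      moreover from this have "(z, b) \<in> R" using zy tR by blast
      ultimately show ?thesis using b by blast
    qed
  next
    case False
    then obtain b where b: "b \<in> B" "z \<in> G b" using z by auto
    then have "?P (G b)" using B(1) G[of b] by blast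
    then have "\<exists>w'\<in>G b. (z, w') \<in> R \<and> tp w' = tp w" using b(2) w by blast
    with b(1) show ?thesis by blast
  qed
  moreover have "G z \<subseteq> M" "finite (G z)" if "z \<in> B" for z
    using that B(1) G[of z] by auto
  moreover have "A \<subseteq> M" using A(1) by (auto simp: C_def)
  ultimately have "?P ?F" using A(2) B(2) less.prems by (intro conjI ballI impI) auto
  then show ?case by blast
qed

lemma frame_cycle_cluster:
  assumes "trans R" "frame_cycle W R xs" "a \<in> set xs" "b \<in> set xs"
  shows "(a, b) \<in> R"
proof -
  let ?k = "length xs"
  have step: "(xs ! (m mod ?k), xs ! (Suc m mod ?k)) \<in> R" for m
  proof -
    have "m mod ?k < ?k" using assms(3) by (auto intro: mod_less_divisor simp: length_pos_if_in_set)
    then have "(xs ! (m mod ?k), xs ! (Suc (m mod ?k) mod ?k)) \<in> R"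
      using assms(2) by (auto simp: frame_cycle_def)
    then show ?thesis by (simp add: mod_Suc_eq)
  qed
  have path: "(xs ! (i mod ?k), xs ! (Suc (i + d) mod ?k)) \<in> R" for i d
  proof (induction d)
    case (Suc d)
    then show ?case using step[of "Suc (i + d)"] assms(1) by (auto dest: transD)
  qed (use step in simp)
  obtain i j where ij: "i < ?k" "xs ! i = a" "j < ?k" "xs ! j = b"
    using assms(3,4) by (auto simp: in_set_conv_nth)
  \<comment> \<open>Adding a full turn \<open>?k\<close> makes the path nonempty even for
    \<open>a = b\<close>, which gives reflexivity on the cycle.\<close>
  then have "Suc (i + (?k - Suc i + j)) = j + ?k" by simp
  then obtain d where "Suc (i + d) = j + ?k" by blast
  with path[of i d] ij show ?thesis by simp
qed

text \<open>A list rather than a set, so that \<open>type_fm\<close> can conjoin over it.\<close>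

fun subfms :: "'v fm \<Rightarrow> 'v fm list" where
  "subfms (Var v) = [Var v]"
| "subfms Top = [Top]"
| "subfms (Neg p) = Neg p # subfms p"
| "subfms (And p q) = And p q # subfms p @ subfms q"
| "subfms (Box p) = Box p # subfms p"

lemma subfms_self: "p \<in> set (subfms p)"
  by (cases p) auto

lemma subfms_closed:
  "Neg q \<in> set (subfms p) \<Longrightarrow> q \<in> set (subfms p)"
  "And q r \<in> set (subfms p) \<Longrightarrow> q \<in> set (subfms p)"
  "And q r \<in> set (subfms p) \<Longrightarrow> r \<in> set (subfms p)"
  "Box q \<in> set (subfms p) \<Longrightarrow> q \<in> set (subfms p)"
  by (induction p) (auto simp: subfms_self)

lemma (in k4_logic) finite_countermodel:
  assumes CC: "\<And>p0 ps. length ps = n \<Longrightarrow> CC p0 ps \<in> L" and "\<phi> \<notin> L"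
  shows "\<exists>(W :: 'v fm set set) R. frame W R \<and> finite W \<and> trans R \<and>
    circumference W R \<le> enat n \<and> \<not> valid_in W R \<phi>"
proof -
  define qs where "qs = subfms \<phi>"
  define tp where "tp y = y \<inter> set qs" for y
  define M where "M = {y. mcs y \<and> maximal_for (type_fm qs y) y}"
  \<comment> \<open>Points are identified when they share both type and cluster; \<open>M'\<close>
    keeps one representative per class.\<close>
  define E where "E y z \<longleftrightarrow> tp y = tp z \<and> (y = z \<or> (y, z) \<in> canon \<and> (z, y) \<in> canon)" for y z
  define rep where "rep y = (SOME z. z \<in> M \<and> E y z)" for y
  define M' where "M' = rep ` M"
  note tR = transD[OF trans_canon]
  have E_refl: "E y y" for y by (simp add: E_def)
  have E_sym: "E z y" if "E y z" for y z using that by (auto simp: E_def)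
  have E_trans: "E y w" if "E y z" "E z w" for y z w
    using that tR unfolding E_def by metis
  have rep: "rep y \<in> M \<and> E y (rep y)" if "y \<in> M" for y
    unfolding rep_def by (rule someI[of _ y]) (use that E_refl in auto)
  have M'_sub: "M' \<subseteq> M" using rep by (auto simp: M'_def)
  have M'_eq: "a = b" if "a \<in> M'" "b \<in> M'" "E a b" for a b
  proof -
    from that obtain u v where uv: "u \<in> M" "v \<in> M" "a = rep u" "b = rep v" by (auto simp: M'_def)
    then have "E u v" using rep that(3) E_sym E_trans by metis
    \<comment> \<open>Equality of the predicates makes the two choices by \<open>SOME\<close> in
      \<open>rep\<close> coincide.\<close>
    then have "E u = E v" using E_sym E_trans by blast
    then show ?thesis using uv by (simp add: rep_def)
  qed
  have M_max: "(z, y) \<in> canon" if "y \<in> M" "(y, z) \<in> canon" "tp z = tp y" for y z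
    using that mcs_type_fm[OF canon_mcs2[OF that(2)]]
    by (auto simp: M_def maximal_for_def tp_def)
  have type_M: "type_fm qs y = type_fm qs z" if "tp y = tp z" for y z
    using that by (auto simp: type_fm_def tp_def intro!: arg_cong[where f = Conj])
  \<comment> \<open>From \<open>y\<close> one passes to a maximal point of its type and then to the
    representative of its class; both remain successors of \<open>x\<close>.\<close>
  have ex: "\<exists>z\<in>M'. (x, z) \<in> canon \<and> tp z = tp y" if xy: "(x, y) \<in> canon" for x y
  proof -
    have "type_fm qs y \<in> y" using canon_mcs2[OF xy] by (simp add: mcs_type_fm)
    from exists_maximal_for[OF xy this] obtain z where z: "(x, z) \<in> canon" "type_fm qs y \<in> z"
      "maximal_for (type_fm qs y) z" by blast
    then have "mcs z" "tp z = tp y" using canon_mcs2 by (auto simp: mcs_type_fm tp_def)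
    then have "z \<in> M" using z(3) type_M[of z y] by (simp add: M_def)
    then have "E z (rep z)" "rep z \<in> M'" using rep[of z] by (auto simp: M'_def)
    moreover from this have "(x, rep z) \<in> canon" using z(1) tR unfolding E_def by metis
    ultimately show ?thesis using \<open>tp z = tp y\<close> by (auto simp: E_def)
  qed
  have "consistent {Neg \<phi>}"
  proof (rule ccontr)
    assume "\<not> consistent {Neg \<phi>}"
    then obtain rs where rs: "set rs \<subseteq> {}" "Imp (Conj rs) (Neg (Neg \<phi>)) \<in> L"
      by (rule inconsistent_insertE)
    then have "\<phi> \<in> L" by (auto intro: taut_mp)
    with \<open>\<phi> \<notin> L\<close> show False by contradiction
  qed
  then obtain x0 where x0: "mcs x0" "\<phi> \<notin> x0" using lindenbaum by fastforce
  \<comment> \<open>Only the type of \<open>x0\<close> matters for refuting \<open>\<phi>\<close>.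
    If no successor shares it, \<open>x0\<close> is vacuously maximal and lies in
    \<open>M\<close>.\<close>
  have "\<exists>r\<in>M'. tp r = tp x0"
  proof (cases "\<exists>y. (x0, y) \<in> canon \<and> tp y = tp x0")
    case True
    then show ?thesis using ex by metis
  next
    case False
    then have "x0 \<in> M" using x0 canon_mcs2
      by (auto simp: M_def maximal_for_def tp_def mcs_type_fm)
    then show ?thesis using rep by (auto simp: M'_def E_def)
  qed
  then obtain r where r: "r \<in> M'" "tp r = tp x0" by blast
  have "finite (tp ` M')" by (rule finite_subset[of _ "Pow (set qs)"]) (auto simp: tp_def)
  moreover have "(z, y) \<in> canon" if "y \<in> M'" "(y, z) \<in> canon" "tp z = tp y" for y z
    using M_max[OF _ that(2,3)] M'_sub that(1) by blast
  ultimately have "\<exists>F\<subseteq>M'. finite F \<and> r \<in> F \<and>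
    (\<forall>z\<in>F. \<forall>w\<in>M'. (z, w) \<in> canon \<longrightarrow> (\<exists>w'\<in>F. (z, w') \<in> canon \<and> tp w' = tp w))"
    by (intro finite_selection trans_canon r(1))
  then obtain F where F: "F \<subseteq> M'" "finite F" "r \<in> F"
    and sel: "\<And>z w. z \<in> F \<Longrightarrow> w \<in> M' \<Longrightarrow> (z, w) \<in> canon \<Longrightarrow>
      \<exists>w'\<in>F. (z, w') \<in> canon \<and> tp w' = tp w"
    by blast
  define R where "R = canon \<inter> F \<times> F"
  have Fm: "mcs z" if "z \<in> F" for z using that F M'_sub by (auto simp: M_def)
  define V where "V v = {z \<in> F. Var v \<in> z}" for v
  have truth: "holds_at F R V z p \<longleftrightarrow> p \<in> z" if "p \<in> set qs" "z \<in> F" for p z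
    using that
  proof (induction p arbitrary: z)
    case (Box p)
    have p: "p \<in> set qs" using Box.prems(1) subfms_closed by (auto simp: qs_def)
    show ?case
    proof
      assume *: "holds_at F R V z (Box p)"
      show "Box p \<in> z"
      proof (rule ccontr)
        assume "Box p \<notin> z"
        then obtain y where y: "(z, y) \<in> canon" "p \<notin> y" using canon_Box_iff Fm Box.prems by blast
        \<comment> \<open>The refuting successor is replaced first by a point of \<open>M'\<close>,
          then by one of \<open>F\<close>; both have its type and so omit \<open>p\<close>.\<close>
        from ex[OF y(1)] obtain u where u: "u \<in> M'" "(z, u) \<in> canon" "tp u = tp y" by blast
        from sel[OF Box.prems(2) u(1,2)] obtain w
          where w: "w \<in> F" "(z, w) \<in> canon" "tp w = tp u" by blast
        then have "p \<in> w" using * Box.IH[OF p] Box.prems by (auto simp: R_def)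
        then show False using w u y p by (auto simp: tp_def)
      qed
    next
      assume "Box p \<in> z"
      then show "holds_at F R V z (Box p)"
        using Box.IH[OF p] canonD by (auto simp: R_def)
    qed
  next
    case (Neg p)
    moreover have "p \<in> set qs" using Neg.prems(1) subfms_closed by (auto simp: qs_def)
    ultimately show ?case using Fm by simp
  next
    case (And p q)
    moreover have "p \<in> set qs" "q \<in> set qs"
      using And.prems(1) subfms_closed by (auto simp: qs_def)
    ultimately show ?case using Fm by simp
  qed (use Fm in \<open>simp_all add: V_def\<close>)
  have "\<phi> \<notin> r" using r(2) x0(2) subfms_self by (auto simp: tp_def qs_def)
  then have "\<not> holds_at F R V r \<phi>" using truth F(3) subfms_self by (auto simp: qs_def)
  then have "\<not> valid_in F R \<phi>" 
    using F(3) unfolding valid_in_def by (auto simp: V_def intro!: exI[of _ V])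
  moreover have "circumference F R \<le> enat n"
    unfolding circumference_le_iff
  proof (intro allI impI)
    fix xs assume xs: "frame_cycle F R xs"
    have tR': "trans R" using trans_canon by (auto simp: R_def trans_def)
    have cl: "(a, b) \<in> canon" if "a \<in> set xs" "b \<in> set xs" for a b
      using frame_cycle_cluster[OF tR' xs that] by (simp add: R_def)
    have sub: "set xs \<subseteq> F" "distinct xs" using xs by (auto simp: frame_cycle_def)
    \<comment> \<open>A cycle lies in one canonical cluster, so two of its points with equal type
      are \<open>E\<close>-equivalent and hence the same representative. Its length therefore counts
      types.\<close>
    have "inj_on tp (set xs)"
    proof (rule inj_onI)
      fix a b assume ab: "a \<in> set xs" "b \<in> set xs" "tp a = tp b"
      then have "E a b" using cl by (simp add: E_def)
      then show "a = b" using ab sub(1) F(1) by (intro M'_eq) auto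
    qed
    then have "distinct (map (\<lambda>x. x \<inter> set qs) xs)"
      using sub by (simp add: distinct_map tp_def[abs_def])
    moreover have "maximal_for (type_fm qs x) x" if "x \<in> set xs" for x
      using that sub F(1) M'_sub by (auto simp: M_def)
    ultimately show "length xs \<le> n" using canon_cluster_types[OF CC cl] by blast
  qed
  moreover have "frame F R" "trans R"
    using trans_canon by (auto simp: R_def frame_def trans_def)
  ultimately show ?thesis using F(2) by blast
qed

section \<open>Transfer to an arbitrary infinite type\<close>

text \<open>The valuation is cut down to \<open>W\<close> before taking images because injectivity
  of \<open>f\<close> is assumed on \<open>W\<close> only.\<close>

lemma holds_at_image:
  assumes "inj_on f W" "frame W R" "x \<in> W"
  shows "holds_at (f ` W) (map_prod f f ` R) (\<lambda>v. f ` (V v \<inter> W)) (f x) p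
    \<longleftrightarrow> holds_at W R V x p"
  using assms(3)
proof (induction p arbitrary: x)
  case (Var v)
  then show ?case using assms(1) by (auto dest: inj_onD)
next
  case (Box p)
  have "(f x, f y) \<in> map_prod f f ` R \<longleftrightarrow> (x, y) \<in> R" if "y \<in> W" for y
  proof
    assume "(f x, f y) \<in> map_prod f f ` R"
    then obtain a b where "(a, b) \<in> R" "f x = f a" "f y = f b" by auto
    moreover from this have "a \<in> W" "b \<in> W" using assms(2) by (auto simp: frame_def)
    ultimately show "(x, y) \<in> R" using inj_onD[OF assms(1)] that Box.prems by metis
  qed force
  with Box show ?case by auto
qed auto

lemma frame_cycle_image:
  assumes f: "inj_on f W" and R: "frame W R"
    and xs: "frame_cycle (f ` W) (map_prod f f ` R) xs"
  shows "frame_cycle W R (map (inv_into W f) xs)"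
proof -
  have "(inv_into W f a, inv_into W f b) \<in> R" if "(a, b) \<in> map_prod f f ` R" for a b
    using that f R by (auto simp: frame_def)
  moreover have "inj_on (inv_into W f) (set xs)"
    using xs by (intro inj_on_inv_into) (auto simp: frame_cycle_def)
  moreover have "inv_into W f ` set xs \<subseteq> W"
    using xs by (auto simp: frame_cycle_def intro!: inv_into_into)
  ultimately show ?thesis
    using xs by (auto simp: frame_cycle_def distinct_map)
qed

text \<open>The countermodel consists of sets of formulas. Being finite, it has an isomorphic copy
  in any infinite type \<open>'w\<close>.\<close>

lemma valid_finite_any:
  fixes W :: "'a set"
  assumes inf: "infinite (UNIV :: 'w set)" and val: "valid_finite TYPE('w) n \<phi>"
    and W: "frame W R" "finite W" "trans R" "circumference W R \<le> enat n"
  shows "valid_in W R \<phi>"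
proof -
  obtain B :: "'w set" where "finite B" "card B = card W"
    using infinite_arbitrarily_large[OF inf] by blast
  then obtain f where "bij_betw f W B" using W(2) finite_same_card_bij by metis
  then have f: "inj_on f W" by (rule bij_betw_imp_inj_on)
  let ?R = "map_prod f f ` R"
  have "frame (f ` W) ?R" using W(1) by (auto simp: frame_def)
  moreover have "trans ?R"
  proof (rule transI)
    fix a b c assume "(a, b) \<in> ?R" "(b, c) \<in> ?R"
    then obtain x y y' z where "(x, y) \<in> R" "(y', z) \<in> R" "f y = f y'" "a = f x" "c = f z" by auto
    moreover from this have "y = y'" using f W(1) by (auto simp: frame_def dest: inj_onD)
    ultimately show "(a, c) \<in> ?R" using transD[OF W(3)] by force
  qed
  moreover have "circumference (f ` W) ?R \<le> enat n"
    using W(4) frame_cycle_image[OF f W(1)] unfolding circumference_le_iff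
    by (metis length_map)
  ultimately have val': "valid_in (f ` W) ?R \<phi>"
    using val W(2) unfolding valid_finite_def by blast
  have "holds_at (f ` W) ?R (\<lambda>v. f ` (V v \<inter> W)) (f x) \<phi>" if "x \<in> W" for V x
    by (rule val'[unfolded valid_in_def, rule_format]) (use that in auto)
  then show ?thesis by (simp add: valid_in_def holds_at_image[OF f W(1)])
qed

section \<open>The least logic and the equivalence\<close>

lemma k4_logicI:
  assumes "normal_logic L" and "\<forall>p. Imp (Box p) (Box (Box p)) \<in> L"
  shows "k4_logic L"
  using assms unfolding normal_logic_def k4_logic_def by (elim conjE) (intro conjI)

text \<open>Every condition of the locale is preserved by intersections.\<close>

lemma k4_logic_K4C: "k4_logic (K4C n :: 'v fm set)"
proof -
  define \<A> where "\<A> = {L :: 'v fm set. normal_logic L \<and>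
    (\<forall>p. Imp (Box p) (Box (Box p)) \<in> L) \<and> (\<forall>p0 ps. length ps = n \<longrightarrow> CC p0 ps \<in> L)}"
  have K4C: "K4C n = \<Inter>\<A>" by (simp add: K4C_def \<A>_def)
  have A: "k4_logic L" if "L \<in> \<A>" for L
    using that unfolding \<A>_def by (intro k4_logicI) blast+
  show ?thesis
  proof
    fix p q :: "'v fm"
    show "p \<in> K4C n" if "tautology p"
      using k4_logic.taut[OF A that] unfolding K4C by blast
    show "Imp (Box (Imp p q)) (Imp (Box p) (Box q)) \<in> K4C n"
      using k4_logic.K[OF A] unfolding K4C by blast
    show "q \<in> K4C n" if "p \<in> K4C n" "Imp p q \<in> K4C n"
      using k4_logic.mp[OF A] that unfolding K4C by blast
    show "Box p \<in> K4C n" if "p \<in> K4C n"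
      using k4_logic.nec[OF A] that unfolding K4C by blast
    show "Imp (Box p) (Box (Box p)) \<in> K4C n"
      using k4_logic.four[OF A] unfolding K4C by blast
  qed
qed

lemma CC_in_K4C: "length ps = n \<Longrightarrow> CC p0 ps \<in> K4C n"
  unfolding K4C_def by blast

theorem theorem6p2:
  fixes n :: nat and \<phi> :: "'v fm"
  assumes "infinite (UNIV :: 'w set)"
  shows "(\<phi> \<in> K4C n \<longleftrightarrow> valid_no_chains TYPE('w) n \<phi>) \<and>
         (\<phi> \<in> K4C n \<longleftrightarrow> valid_finite TYPE('w) n \<phi>)"
proof -
  have "valid_no_chains TYPE('w) n \<phi>" if "\<phi> \<in> K4C n"
    using that K4C_sound unfolding valid_no_chains_def by blast
  moreover have "valid_finite TYPE('w) n \<phi>" if "valid_no_chains TYPE('w) n \<phi>"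
    using that finite_no_ascending_chain unfolding valid_finite_def valid_no_chains_def by blast
  moreover have "\<phi> \<in> K4C n" if "valid_finite TYPE('w) n \<phi>"
    using k4_logic.finite_countermodel[OF k4_logic_K4C CC_in_K4C]
      valid_finite_any[OF assms that] by blast
  ultimately show ?thesis by blast
qed

end
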